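(* Let $L_H=(H_1,\dots,H_n)$, $\{H_i\}\subseteq\{S_k\}$, $n\ge 3$, be a star connected $S$-cycle containing at least three squares. Then the outermost boundary $\partial_0(L_H)$ of $L_H$ is a single cycle.
   Context: Tile $\mathbb{R}^2$ into unit squares $\{S_k\}_{k\ge 0}$ (disjoint except for shared edges and corners), with the origin being the centre of $S_0$. Two distinct squares are star adjacent if they share a corner (squares sharing an edge are in particular star adjacent). A star connected $S$-path is a sequence of distinct squares $(Q_1,\dots,Q_n)$ such that $Q_i$ is star adjacent to $Q_{i+1}$ for $1\le i\le n-1$. A star connected $S$-cycle is a sequence $(Q_1,\dots,Q_n)$ of distinct squares with $n\ge 3$ which is a star connected $S$-path and for which $Q_n$ is also star adjacent to $Q_1$. For a collection $A$ of squares, let $G_A$ be the graph whose vertices are the corners of the squares in $A$ and whose edges are the (unit length) edges of the squares in $A$. A cycle in $G_A$ is a closed path of distinct edges without repeated vertices (a simple closed lattice polygon). A cycle divides the plane into a bounded region, its interior, and an unbounded region, its exterior. A square lies in the interior (exterior) of a cycle if its open unit square lies in the interior (exterior) region. An edge lies in the interior (exterior) of a cycle if both of the squares of $\{S_k\}$ having it as an edge lie in the interior (exterior) of the cycle. An edge $e$ of $G_A$ is an outermost boundary edge of $A$ if for every cycle $C$ in $G_A$, either $e$ is an edge of $C$ or $e$ lies in the exterior of $C$. The outermost boundary of $A$ is the set of all outermost boundary edges of $A$. The outermost boundary $\partial_0(L_H)$ of an $S$-cycle $L_H$ is the outermost boundary of the set of squares in it. *)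

theory Defs
  imports "HOL-Analysis.Analysis"
begin

text \<open>
  The plane is \<^typ>\<open>complex\<close>. The squares of the tiling are indexed by their centres, the points
  with integer coordinates; the square called \<open>S\<^sub>0\<close> has index \<open>(0, 0)\<close>.
\<close>

type_synonym square = "int \<times> int"

definition centre :: "square \<Rightarrow> complex" where
  "centre q = Complex (real_of_int (fst q)) (real_of_int (snd q))"

definition open_square :: "square \<Rightarrow> complex set" where
  "open_square q = box (centre q - Complex (1/2) (1/2)) (centre q + Complex (1/2) (1/2))"

definition corners :: "square \<Rightarrow> complex set" where
  "corners q = {centre q + Complex a b |a b. a \<in> {-1/2, 1/2} \<and> b \<in> {-1/2, 1/2}}"

text \<open>
  An edge is represented by the set of its two end points; the segment it stands for is the
  convex hull of that set. Two corners of a unit square are at distance 1 exactly when they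
  are the ends of a side.
\<close>

definition square_edges :: "square \<Rightarrow> complex set set" where
  "square_edges q = {{u, v} |u v. u \<in> corners q \<and> v \<in> corners q \<and> dist u v = 1}"

definition star_adjacent :: "square \<Rightarrow> square \<Rightarrow> bool" where
  "star_adjacent p q \<longleftrightarrow> p \<noteq> q \<and> corners p \<inter> corners q \<noteq> {}"

definition star_path :: "square list \<Rightarrow> bool" where
  "star_path Q \<longleftrightarrow> distinct Q \<and>
     (\<forall>i. Suc i < length Q \<longrightarrow> star_adjacent (Q ! i) (Q ! Suc i))"

definition star_cycle :: "square list \<Rightarrow> bool" where
  "star_cycle Q \<longleftrightarrow> 3 \<le> length Q \<and> star_path Q \<and> star_adjacent (last Q) (hd Q)"

definition graph_vertices :: "square set \<Rightarrow> complex set" where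
  "graph_vertices A = (\<Union>q\<in>A. corners q)"

definition graph_edges :: "square set \<Rightarrow> complex set set" where
  "graph_edges A = (\<Union>q\<in>A. square_edges q)"

text \<open>
  A cycle is given by the cyclic list of its vertices. Distinctness of the edges excludes
  lists of length 2, which would traverse one edge back and forth; a list of length 1 has
  only the degenerate edge \<open>{v}\<close>, which is not an edge of a square.
\<close>

definition cycle_edges :: "complex list \<Rightarrow> complex set list" where
  "cycle_edges C = map (\<lambda>i. {C ! i, C ! (Suc i mod length C)}) [0..<length C]"

definition is_cycle :: "square set \<Rightarrow> complex list \<Rightarrow> bool" where
  "is_cycle A C \<longleftrightarrow> C \<noteq> [] \<and> distinct C \<and> distinct (cycle_edges C) \<and>
     set C \<subseteq> graph_vertices A \<and> set (cycle_edges C) \<subseteq> graph_edges A"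

definition cycle_curve :: "complex list \<Rightarrow> complex set" where
  "cycle_curve C = (\<Union>e \<in> set (cycle_edges C). convex hull e)"

text \<open>
  The exterior region of a cycle is \<^const>\<open>outside\<close> of its curve, the set of points of the
  complement lying in an unbounded component.
\<close>

definition square_in_exterior :: "square \<Rightarrow> complex list \<Rightarrow> bool" where
  "square_in_exterior q C \<longleftrightarrow> open_square q \<subseteq> outside (cycle_curve C)"

text \<open>
  In the next definition \<open>q\<close> ranges over all squares of the tiling, not only those of a given
  collection, so exactly two squares have a given edge.
\<close>

definition edge_in_exterior :: "complex set \<Rightarrow> complex list \<Rightarrow> bool" where
  "edge_in_exterior e C \<longleftrightarrow> (\<forall>q. e \<in> square_edges q \<longrightarrow> square_in_exterior q C)"

definition outermost_boundary :: "square set \<Rightarrow> complex set set" where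
  "outermost_boundary A = {e \<in> graph_edges A.
     \<forall>C. is_cycle A C \<longrightarrow> e \<in> set (cycle_edges C) \<or> edge_in_exterior e C}"

end

theory Submission imports Defs begin

text \<open>
  Let \<open>A\<close> be the set of squares of the star cycle. Join two squares outside \<open>A\<close> when they share a
  side, and let \<open>O\<close> be the component that reaches infinity (\<open>outer\<close>). All four sides of a square of
  \<open>A\<close> belong to the graph of \<open>A\<close>, and a side shared by two squares outside \<open>A\<close> does not, so a chain
  of neighbouring squares in \<open>O\<close> never crosses a cycle of that graph: the squares of \<open>O\<close> lie in the
  exterior of every cycle. Consider an edge between \<open>O\<close> and its complement (\<open>boundary\<close>). If it is not
  on a given cycle, then the square behind it is joined to \<open>O\<close> across it and so lies in the exterior
  too. Hence all these edges are outermost boundary edges. It remains to find one cycle that runs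
  through all of them and has every square of \<open>A\<close> in its interior, since then no other edge can be
  outermost.

  Around each corner the four squares change between \<open>O\<close> and its complement an even number of times,
  so the boundary of \<open>O\<close> has no end vertices and contains a polygon \<open>P\<close> (\<open>exists_cycle\<close>). A lattice
  polygon is the boundary of a finite set \<open>F\<close> of squares (\<open>polygon_bounds\<close>), namely those from which a
  horizontal ray meets it an odd number of times. As \<open>O\<close> is connected, infinite and not crossed by \<open>P\<close>,
  it is disjoint from \<open>F\<close>; and the square behind an edge of \<open>P\<close>, seen from \<open>O\<close>, is in both \<open>A\<close> and \<open>F\<close>.

  The star cycle cannot leave \<open>F\<close>. Suppose it steps from \<open>p\<close> in \<open>F\<close> to \<open>q\<close> outside. They do not share
  a side, because that side would belong to \<open>P\<close> and so border \<open>O\<close>. If they meet diagonally, the same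
  argument applied to the other two squares \<open>r\<close> and \<open>s\<close> at their common corner shows that \<open>r\<close> and \<open>s\<close>
  both lie in \<open>O\<close>. But the closed walk through the centres of the star cycle crosses the segment
  between the centres of \<open>r\<close> and \<open>s\<close> exactly once, since its squares are distinct and at least three
  in number. It thus separates \<open>r\<close> from \<open>s\<close>, whereas \<open>O\<close> connects them without meeting \<open>A\<close>
  (\<open>not_both_outer\<close>). Without the return path this fails: the outermost boundary of two squares that
  meet only in a corner consists of two cycles.

  Hence \<open>A\<close> is contained in \<open>F\<close>, every edge between \<open>O\<close> and \<open>A\<close> separates \<open>F\<close> from its complement, and \<open>P\<close> is
  the whole boundary of \<open>O\<close> (\<open>outer_boundary_polygon\<close>). Counting parities takes the place of the Jordan
  curve theorem. Topology enters only in showing that squares of \<open>F\<close> do not reach infinity in the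
  complement of \<open>P\<close> (\<open>bounded_region_not_outside\<close>) while squares of \<open>O\<close> do (\<open>outer_centre_outside\<close>).
\<close>

section \<open>Parity of the steps of a closed walk\<close>

definition step_edges :: "'a list \<Rightarrow> 'a set set" where
  "step_edges L = {{L ! i, L ! (Suc i mod length L)} | i. i < length L}"

lemma step_edges_image:
  "step_edges L = (\<lambda>i. {L ! i, L ! (Suc i mod length L)}) ` {..<length L}"
  by (auto simp: step_edges_def)

definition odd_steps :: "'a list \<Rightarrow> ('a \<Rightarrow> 'a \<Rightarrow> bool) \<Rightarrow> bool" where
  "odd_steps L Q \<longleftrightarrow> odd (card {i. i < length L \<and> Q (L ! i) (L ! (Suc i mod length L))})"

lemma odd_steps_cong:
  assumes "\<And>i. i < length L \<Longrightarrow>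
    Q (L ! i) (L ! (Suc i mod length L)) = Q' (L ! i) (L ! (Suc i mod length L))"
  shows "odd_steps L Q = odd_steps L Q'"
proof -
  have "{i. i < length L \<and> Q (L ! i) (L ! (Suc i mod length L))} =
    {i. i < length L \<and> Q' (L ! i) (L ! (Suc i mod length L))}"
    using assms by auto
  then show ?thesis by (simp add: odd_steps_def)
qed

lemma odd_card_sym_diff:
  assumes "finite A" "finite B"
  shows "odd (card (A - B \<union> (B - A))) \<longleftrightarrow> odd (card A) \<noteq> odd (card B)"
proof -
  have "card (A - B \<union> (B - A)) = card (A - B) + card (B - A)"
    using assms by (intro card_Un_disjoint) auto
  moreover have "card A = card (A - B) + card (A \<inter> B)" "card B = card (B - A) + card (A \<inter> B)"
    using assms by (metis card_Diff_subset_Int card_mono finite_Int inf_commute inf_le1 le_add_diff_inverse2)+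
  ultimately show ?thesis by auto
qed

lemma odd_steps_xor:
  "odd_steps L (\<lambda>a b. Q a b \<noteq> Q' a b) \<longleftrightarrow> odd_steps L Q \<noteq> odd_steps L Q'"
proof -
  let ?I = "\<lambda>R. {i. i < length L \<and> R (L ! i) (L ! (Suc i mod length L))}"
  have "?I (\<lambda>a b. Q a b \<noteq> Q' a b) = (?I Q - ?I Q') \<union> (?I Q' - ?I Q)" by auto
  then show ?thesis
    unfolding odd_steps_def using odd_card_sym_diff[of "?I Q" "?I Q'"] by simp
qed

lemma bij_betw_Suc_mod: "bij_betw (\<lambda>i. Suc i mod n) {..<n} {..<n}"
proof (cases "n = 0")
  case False
  have "inj_on (\<lambda>i. Suc i mod n) {..<n}"
    by (rule inj_onI) (auto simp: mod_Suc split: if_splits)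
  moreover have "(\<lambda>i. Suc i mod n) ` {..<n} \<subseteq> {..<n}" using False by auto
  ultimately show ?thesis
    by (simp add: bij_betw_def endo_inj_surj)
qed auto

text \<open>
  A closed walk that enters a set has to leave it again: \<open>P\<close> holds equally often at the starts and at
  the ends of the steps.
\<close>

lemma not_odd_steps_change:
  fixes P :: "'a \<Rightarrow> bool"
  shows "\<not> odd_steps L (\<lambda>a b. P a \<noteq> P b)"
proof -
  let ?n = "length L" and ?f = "\<lambda>i. Suc i mod length L"
  have bij: "bij_betw ?f {..<?n} {..<?n}" by (rule bij_betw_Suc_mod)
  have "?f ` {i. i < ?n \<and> P (L ! ?f i)} = {i. i < ?n \<and> P (L ! i)}"
    using bij_betw_imp_surj_on[OF bij] by (auto simp: set_eq_iff image_iff) (metis lessThan_iff)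
  moreover have "inj_on ?f {i. i < ?n \<and> P (L ! ?f i)}"
    using bij_betw_imp_inj_on[OF bij] by (rule inj_on_subset) auto
  ultimately have "card {i. i < ?n \<and> P (L ! ?f i)} = card {i. i < ?n \<and> P (L ! i)}"
    using card_image by fastforce
  then have "odd_steps L (\<lambda>a b. P a) = odd_steps L (\<lambda>a b. P b)"
    by (simp add: odd_steps_def)
  then show ?thesis using odd_steps_xor[of L "\<lambda>a b. P a" "\<lambda>a b. P b"] by blast
qed

text \<open>
  Both invariance arguments below compare the crossings of two rays. The crossings differ by the
  steps entering or leaving a set, which this rule discards, and by one exceptional step.
\<close>

lemma odd_steps_modulo_change:
  fixes P :: "'a \<Rightarrow> bool"
  shows "odd_steps L (\<lambda>a b. Q a b \<noteq> (P a \<noteq> P b)) = odd_steps L Q"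
  using not_odd_steps_change[of L P] odd_steps_xor[of L Q "\<lambda>a b. P a \<noteq> P b"] by blast

text \<open>
  Length two is the exception: there the walk goes back along the edge it came by.
\<close>

lemma step_edges_inj:
  assumes "distinct L" "3 \<le> length L" "i < length L" "j < length L"
    and "{L ! i, L ! (Suc i mod length L)} = {L ! j, L ! (Suc j mod length L)}"
  shows "i = j"
proof -
  have l: "Suc i mod length L < length L" "Suc j mod length L < length L"
    using assms(2) by (auto intro!: mod_less_divisor)
  have "i = j \<or> (i = Suc j mod length L \<and> Suc i mod length L = j)"
    using assms l by (metis doubleton_eq_iff nth_eq_iff_index_eq)
  then show ?thesis
    using assms(2-4) by (auto simp: mod_Suc split: if_splits)
qed

lemma odd_steps_edge:
  assumes "distinct L" "3 \<le> length L"
  shows "odd_steps L (\<lambda>a b. {a, b} = e) \<longleftrightarrow> e \<in> step_edges L"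
proof (cases "e \<in> step_edges L")
  case True
  then obtain i where i: "i < length L" "e = {L ! i, L ! (Suc i mod length L)}"
    by (auto simp: step_edges_def)
  then have "{j. j < length L \<and> {L ! j, L ! (Suc j mod length L)} = e} = {i}"
    using step_edges_inj[OF assms] by blast
  then show ?thesis using True by (simp add: odd_steps_def)
next
  case False
  then have "{j. j < length L \<and> {L ! j, L ! (Suc j mod length L)} = e} = {}"
    by (auto simp: step_edges_def)
  then show ?thesis using False by (simp only: odd_steps_def) simp
qed

lemma closed_walk_const:
  assumes "\<And>i. i < length L \<Longrightarrow> P (L ! i) = P (L ! (Suc i mod length L))"
    and "a \<in> set L" "b \<in> set L"
  shows "P a = P b"
proof -
  have "P (L ! i) = P (L ! 0)" if "i < length L" for i
    using that
  proof (induction i)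
    case (Suc i)
    then show ?case using assms(1)[of i] by simp
  qed simp
  then show ?thesis using assms(2,3) by (metis in_set_conv_nth)
qed

section \<open>A cycle in a graph without end vertices\<close>

text \<open>
  The last vertex of a longest path has a second neighbour, which by maximality lies on the path and
  closes a cycle there.
\<close>

lemma exists_cycle:
  assumes fin: "finite V"
    and V: "\<And>u v. E u v \<Longrightarrow> u \<in> V" and sym: "\<And>u v. E u v \<Longrightarrow> E v u" and irr: "\<And>u. \<not> E u u"
    and ne: "E a b"
    and ext: "\<And>u v. E u v \<Longrightarrow> \<exists>w. w \<noteq> u \<and> E v w"
  obtains C where "distinct C" "3 \<le> length C"
    "\<And>i. i < length C \<Longrightarrow> E (C ! i) (C ! (Suc i mod length C))"
proof -
  define path where "path p \<longleftrightarrow> distinct p \<and> 2 \<le> length p \<and> set p \<subseteq> V \<and>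
     (\<forall>i. Suc i < length p \<longrightarrow> E (p ! i) (p ! Suc i))" for p
  have "path [a, b]"
    using ne irr V[OF ne] V[OF sym[OF ne]] by (auto simp: path_def)
  moreover have "\<forall>p. path p \<longrightarrow> length p < Suc (card V)"
    using fin by (auto simp: path_def) (metis card_mono distinct_card le_imp_less_Suc)
  ultimately obtain p where p: "path p" and mx: "\<And>q. path q \<Longrightarrow> length q \<le> length p"
    using ex_has_greatest_nat[of path _ length] by metis
  let ?n = "length p"
  have n: "2 \<le> ?n" and dp: "distinct p" and pV: "set p \<subseteq> V"
    and pE: "\<And>i. Suc i < ?n \<Longrightarrow> E (p ! i) (p ! Suc i)"
    using p by (auto simp: path_def)
  have "E (p ! (?n - 2)) (p ! (?n - 1))"
  proof -
    have "Suc (?n - 2) = ?n - 1" using n by linarith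
    then show ?thesis using pE[of "?n - 2"] n by simp
  qed
  then obtain w where w: "w \<noteq> p ! (?n - 2)" "E (p ! (?n - 1)) w" using ext by blast
  have "w \<in> set p"
  proof (rule ccontr)
    assume "w \<notin> set p"
    have "E ((p @ [w]) ! i) ((p @ [w]) ! Suc i)" if "Suc i < length (p @ [w])" for i
    proof (cases "Suc i = ?n")
      case True
      then have "i = ?n - 1" by simp
      with True w show ?thesis by (simp add: nth_append)
    next
      case False
      then show ?thesis using that pE[of i] by (simp add: nth_append)
    qed
    then have "path (p @ [w])"
      using \<open>w \<notin> set p\<close> w V[OF sym[OF w(2)]] n dp pV by (simp add: path_def)
    then have "length (p @ [w]) \<le> ?n" by (rule mx)
    then show False by simp
  qed
  then obtain j where j: "j < ?n" "w = p ! j" by (metis in_set_conv_nth)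
  have "j \<noteq> ?n - 1" using w j irr by metis
  moreover have "j \<noteq> ?n - 2" using w j by metis
  \<comment> \<open>The neighbour is neither the last vertex nor its predecessor, so the cycle has at least three vertices.\<close>
  ultimately have j3: "j + 3 \<le> ?n" using j n by linarith
  show thesis
  proof
    show "distinct (drop j p)" using dp by simp
    show "3 \<le> length (drop j p)" using j3 by simp
    fix i assume i: "i < length (drop j p)"
    show "E (drop j p ! i) (drop j p ! (Suc i mod length (drop j p)))"
    proof (cases "Suc i = length (drop j p)")
      case True
      then have "j + i = ?n - 1" using j by simp
      then show ?thesis using w j i True by simp
    next
      case False
      then show ?thesis using i pE[of "j + i"] by auto
    qed
  qed
qed

section \<open>Lattice squares, corners and walls\<close>

text \<open>
  Corners and squares are both named by integer pairs, and the corner \<open>(x, y)\<close> is the upper right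
  corner of the square \<open>(x, y)\<close>.
\<close>

definition unit_step :: "int \<times> int \<Rightarrow> int \<times> int \<Rightarrow> bool" where
  "unit_step c d \<longleftrightarrow> \<bar>fst c - fst d\<bar> + \<bar>snd c - snd d\<bar> = 1"

definition cell_corners :: "int \<times> int \<Rightarrow> (int \<times> int) set" where
  "cell_corners c = {fst c - 1, fst c} \<times> {snd c - 1, snd c}"

definition wall :: "int \<times> int \<Rightarrow> int \<times> int \<Rightarrow> (int \<times> int) set" where
  "wall c d = cell_corners c \<inter> cell_corners d"

definition boundary :: "(int \<times> int) set \<Rightarrow> (int \<times> int) set set" where
  "boundary S = {wall c d | c d. unit_step c d \<and> c \<in> S \<and> d \<notin> S}"

lemma unit_step_sym: "unit_step c d \<Longrightarrow> unit_step d c"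
  by (simp add: unit_step_def abs_minus_commute)

lemma wall_commute: "wall c d = wall d c"
  by (auto simp: wall_def)

lemma wall_right: "wall (x, y) (x + 1, y) = {(x, y - 1), (x, y)}"
  by (auto simp: wall_def cell_corners_def)

lemma wall_up: "wall (x, y) (x, y + 1) = {(x - 1, y), (x, y)}"
  by (auto simp: wall_def cell_corners_def)

text \<open>
  Symmetric statements about neighbours need to be checked only for a right and an upper neighbour.
\<close>

lemma unit_step_induct [consumes 1, case_names right up sym]:
  assumes "unit_step c d"
    and "\<And>x y. P (x, y) (x + 1, y)" "\<And>x y. P (x, y) (x, y + 1)"
    and "\<And>c d. unit_step c d \<Longrightarrow> P c d \<Longrightarrow> P d c"
  shows "P c d"
proof -
  obtain x y where c: "c = (x, y)" by force
  have "d = (x + 1, y) \<or> d = (x, y + 1) \<or> d = (x - 1, y) \<or> d = (x, y - 1)"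
    using assms(1) by (cases d) (auto simp: unit_step_def c)
  moreover have "P (x, y) (x - 1, y)" "P (x, y) (x, y - 1)"
    using assms(4)[OF _ assms(2)[of "x - 1" y]] assms(4)[OF _ assms(3)[of x "y - 1"]]
    by (auto simp: unit_step_def)
  ultimately show ?thesis using assms(2,3) c by auto
qed

lemma unit_step_right: "unit_step (x, y) (x + 1, y)"
  and unit_step_up: "unit_step (x, y) (x, y + 1)"
  by (auto simp: unit_step_def)

lemma wall_inj:
  assumes "unit_step c d" "unit_step c' d'" "wall c d = wall c' d'"
  shows "{c, d} = {c', d'}"
  using assms
proof (induction c d rule: unit_step_induct)
  case (right x y)
  show ?case using right
    by (induction c' d' rule: unit_step_induct)
      (auto simp: wall_right wall_up doubleton_eq_iff wall_commute)
next
  case (up x y)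
  show ?case using up
    by (induction c' d' rule: unit_step_induct)
      (auto simp: wall_right wall_up doubleton_eq_iff wall_commute)
qed (auto simp: wall_commute)

lemma wall_in_boundary_iff:
  assumes "unit_step c d"
  shows "wall c d \<in> boundary S \<longleftrightarrow> (c \<in> S) \<noteq> (d \<in> S)"
proof
  assume "wall c d \<in> boundary S"
  then obtain c' d' where "unit_step c' d'" "c' \<in> S" "d' \<notin> S" "wall c d = wall c' d'"
    by (auto simp: boundary_def)
  with wall_inj[OF assms this(1,4)] show "(c \<in> S) \<noteq> (d \<in> S)" by (auto simp: doubleton_eq_iff)
next
  assume "(c \<in> S) \<noteq> (d \<in> S)"
  then show "wall c d \<in> boundary S"
    using assms unit_step_sym wall_commute unfolding boundary_def by blast
qed

lemma unit_step_wall: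
  assumes "unit_step u v"
  obtains c d where "unit_step c d" "{u, v} = wall c d"
proof -
  have "\<exists>c d. unit_step c d \<and> {u, v} = wall c d"
    using assms
  proof (induction u v rule: unit_step_induct)
    case (right x y)
    have "{(x, y), (x + 1, y)} = wall (x + 1, y) (x + 1, y + 1)" by (simp add: wall_up)
    then show ?case using unit_step_up by blast
  next
    case (up x y)
    have "{(x, y), (x, y + 1)} = wall (x, y + 1) (x + 1, y + 1)" by (simp add: wall_right)
    then show ?case using unit_step_right by blast
  qed (metis insert_commute)
  then show thesis using that by blast
qed

lemma wall_unit_step:
  assumes "unit_step c d"
  obtains u v where "unit_step u v" "wall c d = {u, v}"
proof -
  have "\<exists>u v. unit_step u v \<and> wall c d = {u, v}"
    using assms
  proof (induction c d rule: unit_step_induct)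
    case (right x y)
    show ?case using unit_step_up[of x "y - 1"] by (auto simp: wall_right)
  next
    case (up x y)
    show ?case using unit_step_right[of "x - 1" y] by (auto simp: wall_up)
  qed (metis wall_commute)
  then show thesis using that by blast
qed

lemma boundary_eqI:
  assumes "\<And>c d. unit_step c d \<Longrightarrow> wall c d \<in> E \<longleftrightarrow> (c \<in> S) \<noteq> (d \<in> S)"
    and "\<And>e. e \<in> E \<Longrightarrow> \<exists>u v. unit_step u v \<and> e = {u, v}"
  shows "boundary S = E"
proof (intro subset_antisym subsetI)
  fix e assume "e \<in> boundary S"
  then show "e \<in> E" using assms(1) by (auto simp: boundary_def)
next
  fix e assume "e \<in> E"
  then obtain c d where "unit_step c d" "e = wall c d"
    using assms(2) unit_step_wall by metis
  then show "e \<in> boundary S" using \<open>e \<in> E\<close> assms(1) wall_in_boundary_iff by metis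
qed

section \<open>A lattice polygon bounds a finite set of squares\<close>

text \<open>
  The segment from \<open>a\<close> to \<open>b\<close> meets the ray that runs to the right from the centre of the square \<open>(x, y)\<close>:
  the corners at height \<open>y\<close> lie above this ray, those at height \<open>y - 1\<close> below it.
\<close>

definition right_cross :: "int \<Rightarrow> int \<Rightarrow> int \<times> int \<Rightarrow> int \<times> int \<Rightarrow> bool" where
  "right_cross x y a b \<longleftrightarrow> fst a = fst b \<and> x \<le> fst a \<and> {snd a, snd b} = {y - 1, y}"

lemma right_cross_commute: "right_cross x y a b = right_cross x y b a"
  by (auto simp: right_cross_def insert_commute)

text \<open>
  The even-odd rule. The rays of two horizontal neighbours meet the same edges except for the side
  between the neighbours. The rays of two vertical neighbours enclose a strip of corners, and the
  polygon enters this strip through one of the rays or through the common side.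
\<close>

lemma polygon_bounds:
  assumes "distinct C" "3 \<le> length C"
    and step: "\<And>i. i < length C \<Longrightarrow> unit_step (C ! i) (C ! (Suc i mod length C))"
  obtains F where "finite F" "boundary F = step_edges C"
proof -
  define F where "F = {(x, y). odd_steps C (right_cross x y)}"
  have horizontal: "((x, y) \<in> F) \<noteq> ((x + 1, y) \<in> F) \<longleftrightarrow> {(x, y - 1), (x, y)} \<in> step_edges C" for x y
  proof -
    have "(right_cross x y a b \<noteq> right_cross (x + 1) y a b) \<longleftrightarrow> {a, b} = {(x, y - 1), (x, y)}" for a b
      by (cases a; cases b) (auto simp: right_cross_def doubleton_eq_iff)
    then show ?thesis
      using odd_steps_edge[OF assms(1,2), of "{(x, y - 1), (x, y)}"]
        odd_steps_xor[of C "right_cross x y" "right_cross (x + 1) y"]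
      by (simp add: F_def)
  qed
  have vertical: "((x, y) \<in> F) \<noteq> ((x, y + 1) \<in> F) \<longleftrightarrow> {(x - 1, y), (x, y)} \<in> step_edges C" for x y
  proof -
    \<comment> \<open>The corners between the ray of \<open>(x, y)\<close> and that of \<open>(x, y + 1)\<close>.\<close>
    define P where "P = (\<lambda>a :: int \<times> int. snd a = y \<and> x \<le> fst a)"
    have "((right_cross x y a b \<noteq> right_cross x (y + 1) a b) \<noteq> (P a \<noteq> P b)) \<longleftrightarrow> {a, b} = {(x - 1, y), (x, y)}"
      if "unit_step a b" for a b
      using that
    proof (induction a b rule: unit_step_induct)
      case (right p q) then show ?case by (auto simp: P_def right_cross_def doubleton_eq_iff)
    next
      case (up p q) then show ?case by (auto simp: P_def right_cross_def doubleton_eq_iff)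
    next
      case (sym a b) then show ?case by (simp add: right_cross_commute[of _ _ b] insert_commute[of b]) blast
    qed
    then have "odd_steps C (\<lambda>a b. (right_cross x y a b \<noteq> right_cross x (y + 1) a b) \<noteq> (P a \<noteq> P b))
      \<longleftrightarrow> {(x - 1, y), (x, y)} \<in> step_edges C"
      unfolding odd_steps_edge[OF assms(1,2), symmetric] using step by (intro odd_steps_cong) blast
    then show ?thesis
      by (simp only: odd_steps_modulo_change odd_steps_xor) (simp add: F_def)
  qed
  have bd: "boundary F = step_edges C"
  proof (rule boundary_eqI)
    fix c d assume "unit_step c d"
    then show "wall c d \<in> step_edges C \<longleftrightarrow> (c \<in> F) \<noteq> (d \<in> F)"
    proof (induction c d rule: unit_step_induct)
      case (right x y)
      then show ?case using horizontal by (simp add: wall_right)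
    next
      case (up x y)
      then show ?case using vertical by (simp add: wall_up)
    qed (auto simp: wall_commute)
  next
    fix e assume "e \<in> step_edges C"
    then show "\<exists>u v. unit_step u v \<and> e = {u, v}" using step unfolding step_edges_def by blast
  qed
  obtain B where B: "\<And>a. a \<in> set C \<Longrightarrow> \<bar>fst a\<bar> < B \<and> \<bar>snd a\<bar> < B"
  proof
    fix a assume "a \<in> set C"
    then have "\<bar>fst a\<bar> \<le> (\<Sum>a\<in>set C. \<bar>fst a\<bar> + \<bar>snd a\<bar>)" "\<bar>snd a\<bar> \<le> (\<Sum>a\<in>set C. \<bar>fst a\<bar> + \<bar>snd a\<bar>)"
      using member_le_sum[of a "set C" "\<lambda>a. \<bar>fst a\<bar> + \<bar>snd a\<bar>"] by auto
    then show "\<bar>fst a\<bar> < (\<Sum>a\<in>set C. \<bar>fst a\<bar> + \<bar>snd a\<bar>) + 1 \<and> \<bar>snd a\<bar> < (\<Sum>a\<in>set C. \<bar>fst a\<bar> + \<bar>snd a\<bar>) + 1"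
      by linarith
  qed
  have "F \<subseteq> {-B..B} \<times> {-B..B}"
  proof clarify
    fix x y assume xy: "(x, y) \<in> F"
    then have "{i. i < length C \<and> right_cross x y (C ! i) (C ! (Suc i mod length C))} \<noteq> {}"
      unfolding F_def odd_steps_def by (metis (mono_tags, lifting) card.empty even_zero mem_Collect_eq case_prodD)
    then obtain i where i: "i < length C" "right_cross x y (C ! i) (C ! (Suc i mod length C))" by auto
    then have "x \<le> fst (C ! i)" "snd (C ! i) = y - 1 \<or> snd (C ! i) = y"
      by (auto simp: right_cross_def doubleton_eq_iff)
    with B[OF nth_mem[OF i(1)]] have "x \<le> B" "-B \<le> y" "y \<le> B" by auto
    moreover have "-B \<le> x"
    proof (rule ccontr)
      \<comment> \<open>Far to the left the ray sees every crossing of its height, and these are even in number.\<close>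
      assume "\<not> -B \<le> x"
      have "right_cross x y a b \<longleftrightarrow> (y \<le> snd a) \<noteq> (y \<le> snd b)"
        if "unit_step a b" "x \<le> fst a" "x \<le> fst b" for a b
        using that
      proof (induction a b rule: unit_step_induct)
        case (sym a b) then show ?case by (metis right_cross_commute insert_commute)
      qed (auto simp: right_cross_def doubleton_eq_iff)
      moreover have "x \<le> fst a" if "a \<in> set C" for a
        using B[OF that] \<open>\<not> -B \<le> x\<close> by linarith
      moreover have "Suc i mod length C < length C" if "i < length C" for i
        using that by (intro mod_less_divisor) linarith
      ultimately have "odd_steps C (right_cross x y) = odd_steps C (\<lambda>a b. (y \<le> snd a) \<noteq> (y \<le> snd b))"
        using step by (intro odd_steps_cong) simp
      then show False using xy not_odd_steps_change[of C "\<lambda>a. y \<le> snd a"] by (simp add: F_def)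
    qed
    ultimately show "x \<in> {-B..B} \<and> y \<in> {-B..B}" by simp
  qed
  then have "finite F" by (rule finite_subset) simp
  then show thesis using bd that by blast
qed

section \<open>The outer region and the diagonal steps of a star cycle\<close>

definition king_step :: "int \<times> int \<Rightarrow> int \<times> int \<Rightarrow> bool" where
  "king_step c d \<longleftrightarrow> c \<noteq> d \<and> \<bar>fst c - fst d\<bar> \<le> 1 \<and> \<bar>snd c - snd d\<bar> \<le> 1"

text \<open>
  The moves inside the complement of \<open>A\<close>. The side crossed by such a move is not a side of any
  square in \<open>A\<close>.
\<close>

definition free_step :: "(int \<times> int) set \<Rightarrow> ((int \<times> int) \<times> (int \<times> int)) set" where
  "free_step A = {(c, d). unit_step c d \<and> c \<notin> A \<and> d \<notin> A}"

text \<open>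
  The squares \<open>(m, 0)\<close> with \<open>m\<close> beyond all of \<open>A\<close> represent infinity.
\<close>

definition outer :: "(int \<times> int) set \<Rightarrow> (int \<times> int) set" where
  "outer A = {c. \<exists>m. (\<forall>a\<in>A. fst a < m) \<and> ((m, 0), c) \<in> (free_step A)\<^sup>*}"

lemma free_step_const:
  assumes "\<And>c d. (c, d) \<in> free_step A \<Longrightarrow> P c = P d" "(c, d) \<in> (free_step A)\<^sup>*"
  shows "P c = P d"
  using assms(2) by induction (auto dest: assms(1))

lemma far_right_free:
  assumes "\<forall>a\<in>A. fst a < m" "m \<le> m'"
  shows "((m, 0), (m', 0)) \<in> (free_step A)\<^sup>*"
  using assms(2)
proof (induction m' rule: int_ge_induct)
  case (step i)
  have "((i, 0), (i + 1, 0)) \<in> free_step A"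
    using assms(1) step(1) unit_step_right[of i 0] by (force simp: free_step_def)
  with step.IH show ?case by (rule rtrancl_into_rtrancl)
qed simp

lemma sym_free_step: "sym (free_step A)"
  by (auto simp: sym_def free_step_def unit_step_sym)

lemma outer_connected:
  assumes "c \<in> outer A" "d \<in> outer A"
  shows "(c, d) \<in> (free_step A)\<^sup>*"
proof -
  obtain m n where m: "\<forall>a\<in>A. fst a < m" "((m, 0), c) \<in> (free_step A)\<^sup>*"
    and n: "\<forall>a\<in>A. fst a < n" "((n, 0), d) \<in> (free_step A)\<^sup>*"
    using assms by (auto simp: outer_def)
  have "((m, 0), (n, 0)) \<in> (free_step A)\<^sup>*"
    using far_right_free[OF m(1), of n] far_right_free[OF n(1), of m]
      sym_rtrancl[OF sym_free_step, of A] by (meson linear symD)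
  moreover have "(c, (m, 0)) \<in> (free_step A)\<^sup>*"
    using m(2) sym_rtrancl[OF sym_free_step, of A] by (meson symD)
  ultimately show ?thesis using n(2) by (meson rtrancl_trans)
qed

lemma outer_const:
  assumes "\<And>c d. (c, d) \<in> free_step A \<Longrightarrow> P c = P d" "c \<in> outer A" "d \<in> outer A"
  shows "P c = P d"
  using assms(1) outer_connected[OF assms(2,3)] by (rule free_step_const)

lemma outer_free_step: "(c, d) \<in> free_step A \<Longrightarrow> c \<in> outer A \<longleftrightarrow> d \<in> outer A"
  using sym_free_step[of A] unfolding outer_def by (blast dest: symD intro: rtrancl_into_rtrancl)

lemma outer_not_in: "c \<in> outer A \<Longrightarrow> c \<notin> A"
  by (force simp: outer_def free_step_def elim: rtranclE)

lemma outer_far_right: "\<forall>a\<in>A. fst a < m \<Longrightarrow> (m, 0) \<in> outer A"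
  by (auto simp: outer_def)

text \<open>
  For a step between the centres of \<open>a\<close> and \<open>b\<close>: it meets the ray to the right from the centre of
  \<open>(x, y)\<close>, when the ray is moved up by an infinitesimal amount so that it avoids all centres.
  A step from row \<open>y\<close> to row \<open>y + 1\<close> then meets it at the abscissa of its lower end, up to an
  infinitesimal. The ray is used only for squares that the walk avoids, so it makes no difference how
  a step from \<open>(x, y)\<close> itself is counted.
\<close>

definition north_cross :: "int \<Rightarrow> int \<Rightarrow> int \<times> int \<Rightarrow> int \<times> int \<Rightarrow> bool" where
  "north_cross x y a b \<longleftrightarrow>
     (snd a = y \<and> snd b = y + 1 \<and> x < fst a) \<or> (snd b = y \<and> snd a = y + 1 \<and> x < fst b)"

lemma king_step_cases:
  assumes "king_step (p, q) (p', q')"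
  shows "(p' = p - 1 \<or> p' = p \<or> p' = p + 1) \<and> (q' = q - 1 \<or> q' = q \<or> q' = q + 1)"
  using assms by (simp add: king_step_def) arith

lemma north_cross_right:
  assumes "a \<noteq> (x + 1, y)" "b \<noteq> (x + 1, y)"
  shows "north_cross x y a b = north_cross (x + 1) y a b"
proof -
  have "snd c = y \<Longrightarrow> x < fst c \<longleftrightarrow> x + 1 < fst c" if "c \<noteq> (x + 1, y)" for c :: "int \<times> int"
    using that by (cases c) auto
  from this[OF assms(1)] this[OF assms(2)] show ?thesis by (auto simp: north_cross_def)
qed

text \<open>
  What lies between the two shifted rays are the squares of row \<open>y + 1\<close> to the right of \<open>x\<close>. A step
  into or out of this set passes through exactly one of the rays, because it cannot use the
  excluded squares at the left end.
\<close>

lemma north_cross_up: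
  assumes "king_step a b" "a \<noteq> (x, y)" "b \<noteq> (x, y)" "a \<noteq> (x, y + 1)" "b \<noteq> (x, y + 1)"
  shows "north_cross x y a b \<longleftrightarrow>
    north_cross x (y + 1) a b \<noteq> ((snd a = y + 1 \<and> x < fst a) \<noteq> (snd b = y + 1 \<and> x < fst b))"
proof -
  obtain p q p' q' where ab: "a = (p, q)" "b = (p', q')" by fastforce
  then have "p' = p - 1 \<or> p' = p \<or> p' = p + 1" "q' = q - 1 \<or> q' = q \<or> q' = q + 1"
    using king_step_cases assms(1) by blast+
  then show ?thesis
    using assms(2-) unfolding ab north_cross_def by (elim disjE; cases "q = y"; cases "q = y + 1"; cases "q = y + 2"; simp; arith?)
qed

text \<open>
  Between two squares that touch diagonally the crossings change as between vertical neighbours,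
  except for the one step that passes between them.
\<close>

lemma north_cross_diagonal_right:
  assumes "king_step a b" "a \<noteq> (x + 1, y)" "b \<noteq> (x + 1, y)" "a \<noteq> (x, y + 1)" "b \<noteq> (x, y + 1)"
  shows "{a, b} = {(x, y), (x + 1, y + 1)} \<longleftrightarrow>
    (north_cross (x + 1) y a b \<noteq> north_cross x (y + 1) a b)
      \<noteq> ((snd a = y + 1 \<and> x < fst a) \<noteq> (snd b = y + 1 \<and> x < fst b))"
proof -
  obtain p q p' q' where ab: "a = (p, q)" "b = (p', q')" by fastforce
  then have "p' = p - 1 \<or> p' = p \<or> p' = p + 1" "q' = q - 1 \<or> q' = q \<or> q' = q + 1"
    using king_step_cases assms(1) by blast+
  then show ?thesis
    using assms(2-) unfolding ab north_cross_def doubleton_eq_iff by (elim disjE; cases "q = y"; cases "q = y + 1"; cases "q = y + 2"; simp; arith?)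
qed

lemma north_cross_diagonal_left:
  assumes "king_step a b" "a \<noteq> (x, y)" "b \<noteq> (x, y)" "a \<noteq> (x + 1, y + 1)" "b \<noteq> (x + 1, y + 1)"
  shows "{a, b} = {(x + 1, y), (x, y + 1)} \<longleftrightarrow>
    (north_cross x y a b \<noteq> north_cross (x + 1) (y + 1) a b)
      \<noteq> ((snd a = y + 1 \<and> x + 1 < fst a) \<noteq> (snd b = y + 1 \<and> x + 1 < fst b))"
proof -
  obtain p q p' q' where ab: "a = (p, q)" "b = (p', q')" by fastforce
  then have "p' = p - 1 \<or> p' = p \<or> p' = p + 1" "q' = q - 1 \<or> q' = q \<or> q' = q + 1"
    using king_step_cases assms(1) by blast+
  then show ?thesis
    using assms(2-) unfolding ab north_cross_def doubleton_eq_iff by (elim disjE; cases "q = y"; cases "q = y + 1"; cases "q = y + 2"; simp; arith?)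
qed

text \<open>
  The number of crossings of the star cycle with the ray of a free square does not change its parity
  along free moves, hence is the same for all outer squares. It is different for \<open>r\<close> and \<open>s\<close>, because
  the step between \<open>p\<close> and \<open>q\<close> occurs exactly once.
\<close>

lemma not_both_outer:
  assumes H: "distinct H" "3 \<le> length H"
    and king: "\<And>i. i < length H \<Longrightarrow> king_step (H ! i) (H ! (Suc i mod length H))"
    and pq: "{p, q} \<in> step_edges H"
    and diag: "(p = (x, y) \<and> q = (x + 1, y + 1) \<and> r = (x + 1, y) \<and> s = (x, y + 1)) \<or>
      (p = (x + 1, y) \<and> q = (x, y + 1) \<and> r = (x, y) \<and> s = (x + 1, y + 1))"
  shows "r \<notin> outer (set H) \<or> s \<notin> outer (set H)"
proof (rule ccontr)
  assume "\<not> ?thesis"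
  then have rs: "r \<in> outer (set H)" "s \<in> outer (set H)" by auto
  then have rsH: "r \<notin> set H" "s \<notin> set H" using outer_not_in by auto
  let ?N = "\<lambda>c. odd_steps H (north_cross (fst c) (snd c))"
  have cong: "odd_steps H Q = odd_steps H Q'"
    if Q: "\<And>a b. king_step a b \<Longrightarrow> a \<in> set H \<Longrightarrow> b \<in> set H \<Longrightarrow> Q a b = Q' a b" for Q Q'
  proof (rule odd_steps_cong)
    fix i assume i: "i < length H"
    then have "Suc i mod length H < length H" by (intro mod_less_divisor) linarith
    then show "Q (H ! i) (H ! (Suc i mod length H)) = Q' (H ! i) (H ! (Suc i mod length H))"
      using Q king i by simp
  qed
  have N: "?N c = ?N d" if "(c, d) \<in> free_step (set H)" for c d
  proof -
    have "unit_step c d" "c \<notin> set H" "d \<notin> set H" using that by (auto simp: free_step_def)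
    then show ?thesis
    proof (induction c d rule: unit_step_induct)
      case (right x y)
      have "north_cross x y a b = north_cross (x + 1) y a b" if "a \<in> set H" "b \<in> set H" for a b
        using that right by (intro north_cross_right) auto
      then show ?case unfolding fst_conv snd_conv by (intro cong)
    next
      case (up x y)
      define P where "P = (\<lambda>a :: int \<times> int. snd a = y + 1 \<and> x < fst a)"
      have "north_cross x y a b \<longleftrightarrow> north_cross x (y + 1) a b \<noteq> (P a \<noteq> P b)"
        if "king_step a b" "a \<in> set H" "b \<in> set H" for a b
        unfolding P_def using that up by (intro north_cross_up) auto
      then have "odd_steps H (north_cross x y) =
        odd_steps H (\<lambda>a b. north_cross x (y + 1) a b \<noteq> (P a \<noteq> P b))"
        by (rule cong)
      then show ?case by (simp only: odd_steps_modulo_change fst_conv snd_conv)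
    next
      case (sym c d)
      then show ?case by blast
    qed
  qed
  have "?N r = ?N s" by (rule outer_const[OF N rs])
  define P where "P = (\<lambda>a. snd a = snd s \<and> fst s < fst a)"
  have "{a, b} = {p, q} \<longleftrightarrow>
      (north_cross (fst r) (snd r) a b \<noteq> north_cross (fst s) (snd s) a b) \<noteq> (P a \<noteq> P b)"
    if "king_step a b" "a \<in> set H" "b \<in> set H" for a b
    using diag
  proof (elim disjE conjE)
    assume eqs: "p = (x, y)" "q = (x + 1, y + 1)" "r = (x + 1, y)" "s = (x, y + 1)"
    then have "a \<noteq> r" "b \<noteq> r" "a \<noteq> s" "b \<noteq> s" using that(2,3) rsH by blast+
    then show ?thesis
      using north_cross_diagonal_right[OF that(1), of x y] unfolding P_def eqs fst_conv snd_conv by blast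
  next
    assume eqs: "p = (x + 1, y)" "q = (x, y + 1)" "r = (x, y)" "s = (x + 1, y + 1)"
    then have "a \<noteq> r" "b \<noteq> r" "a \<noteq> s" "b \<noteq> s" using that(2,3) rsH by blast+
    then show ?thesis
      using north_cross_diagonal_left[OF that(1), of x y] unfolding P_def eqs fst_conv snd_conv by blast
  qed
  then have "odd_steps H (\<lambda>a b. {a, b} = {p, q}) =
      odd_steps H (\<lambda>a b. (north_cross (fst r) (snd r) a b \<noteq> north_cross (fst s) (snd s) a b) \<noteq> (P a \<noteq> P b))"
    by (rule cong)
  then have "?N r \<noteq> ?N s \<longleftrightarrow> {p, q} \<in> step_edges H"
    by (simp only: odd_steps_modulo_change odd_steps_xor odd_steps_edge[OF H])
  with \<open>?N r = ?N s\<close> pq show False by blast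
qed

section \<open>The boundary of the outer region is a polygon around all squares\<close>

lemma unit_step_const:
  assumes "\<And>c d. unit_step c d \<Longrightarrow> P c = P d"
  shows "P c = P d"
proof -
  have x: "P (x, y) = P (0, y)" for x y
  proof (induction x rule: int_induct[of _ 0])
    case (step2 i)
    then show ?case using assms[OF unit_step_right[of "i - 1" y]] by simp
  qed (use assms[OF unit_step_right] in auto)
  have y: "P (0, y) = P (0, 0)" for y
  proof (induction y rule: int_induct[of _ 0])
    case (step2 i)
    then show ?case using assms[OF unit_step_up[of 0 "i - 1"]] by simp
  qed (use assms[OF unit_step_up] in auto)
  show ?thesis by (cases c; cases d) (metis x y)
qed

text \<open>
  Going once around the corner \<open>v\<close>, membership in \<open>S\<close> cannot change only once.
\<close>

lemma boundary_extend:
  assumes "unit_step u v" "{u, v} \<in> boundary S"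
  shows "\<exists>w. w \<noteq> u \<and> unit_step v w \<and> {v, w} \<in> boundary S"
proof -
  obtain i j where v: "v = (i, j)" by fastforce
  have W: "{v, (i, j - 1)} \<in> boundary S \<longleftrightarrow> ((i, j) \<in> S) \<noteq> ((i + 1, j) \<in> S)"
    "{v, (i - 1, j)} \<in> boundary S \<longleftrightarrow> ((i, j) \<in> S) \<noteq> ((i, j + 1) \<in> S)"
    "{v, (i, j + 1)} \<in> boundary S \<longleftrightarrow> ((i, j + 1) \<in> S) \<noteq> ((i + 1, j + 1) \<in> S)"
    "{v, (i + 1, j)} \<in> boundary S \<longleftrightarrow> ((i + 1, j) \<in> S) \<noteq> ((i + 1, j + 1) \<in> S)"
    using wall_in_boundary_iff[OF unit_step_right[of i j], of S]
      wall_in_boundary_iff[OF unit_step_up[of i j], of S]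
      wall_in_boundary_iff[OF unit_step_right[of i "j + 1"], of S]
      wall_in_boundary_iff[OF unit_step_up[of "i + 1" j], of S]
    by (simp_all add: v wall_right wall_up insert_commute)
  have U: "unit_step v (i, j - 1)" "unit_step v (i - 1, j)" "unit_step v (i, j + 1)" "unit_step v (i + 1, j)"
    by (auto simp: v unit_step_def)
  have "u = (i, j - 1) \<or> u = (i - 1, j) \<or> u = (i, j + 1) \<or> u = (i + 1, j)"
    using assms(1) by (cases u) (auto simp: v unit_step_def)
  then consider "u = (i, j - 1)" | "u = (i - 1, j)" | "u = (i, j + 1)" | "u = (i + 1, j)" by blast
  moreover have e: "{v, u} \<in> boundary S" using assms(2) by (simp add: insert_commute)
  ultimately show ?thesis
  proof cases
    case 1
    have "{v, (i - 1, j)} \<in> boundary S \<or> {v, (i, j + 1)} \<in> boundary S \<or> {v, (i + 1, j)} \<in> boundary S"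
      using e unfolding 1 W by blast
    moreover have "(i - 1, j) \<noteq> u" "(i, j + 1) \<noteq> u" "(i + 1, j) \<noteq> u" using 1 by auto
    ultimately show ?thesis using U by blast
  next
    case 2
    have "{v, (i, j - 1)} \<in> boundary S \<or> {v, (i, j + 1)} \<in> boundary S \<or> {v, (i + 1, j)} \<in> boundary S"
      using e unfolding 2 W by blast
    moreover have "(i, j - 1) \<noteq> u" "(i, j + 1) \<noteq> u" "(i + 1, j) \<noteq> u" using 2 by auto
    ultimately show ?thesis using U by blast
  next
    case 3
    have "{v, (i, j - 1)} \<in> boundary S \<or> {v, (i - 1, j)} \<in> boundary S \<or> {v, (i + 1, j)} \<in> boundary S"
      using e unfolding 3 W by blast
    moreover have "(i, j - 1) \<noteq> u" "(i - 1, j) \<noteq> u" "(i + 1, j) \<noteq> u" using 3 by auto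
    ultimately show ?thesis using U by blast
  next
    case 4
    have "{v, (i, j - 1)} \<in> boundary S \<or> {v, (i - 1, j)} \<in> boundary S \<or> {v, (i, j + 1)} \<in> boundary S"
      using e unfolding 4 W by blast
    moreover have "(i, j - 1) \<noteq> u" "(i - 1, j) \<noteq> u" "(i, j + 1) \<noteq> u" using 4 by auto
    ultimately show ?thesis using U by blast
  qed
qed

lemma diagonal_stepE:
  assumes "king_step p q" "\<not> unit_step p q"
  obtains x y where "{p, q} = {(x, y), (x + 1, y + 1)}" | x y where "{p, q} = {(x + 1, y), (x, y + 1)}"
proof -
  obtain a b a' b' where pq: "p = (a, b)" "q = (a', b')" by fastforce
  have "(a' = a + 1 \<or> a' = a - 1) \<and> (b' = b + 1 \<or> b' = b - 1)"
    using assms unfolding pq king_step_def unit_step_def by auto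
  then show thesis
    using that(1)[of a b] that(1)[of a' b'] that(2)[of a b'] that(2)[of a' b]
    by (auto simp: pq insert_commute)
qed

lemma outer_neighbour:
  assumes "c \<in> outer A" "d \<notin> outer A" "unit_step c d"
  shows "d \<in> A"
proof (rule ccontr)
  assume "d \<notin> A"
  then have "(c, d) \<in> free_step A" using assms outer_not_in by (simp add: free_step_def)
  then show False using assms(1,2) outer_free_step by blast
qed

text \<open>
  Any polygon in the boundary of the outer region will do: the star cycle cannot leave the region \<open>F\<close>
  that the polygon bounds, so every edge between the outer region and a square of the star cycle
  separates \<open>F\<close> from its complement and lies on the polygon.
\<close>

lemma outer_boundary_polygon:
  assumes H: "distinct H" "3 \<le> length H"
    and king: "\<And>i. i < length H \<Longrightarrow> king_step (H ! i) (H ! (Suc i mod length H))"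
  obtains C F where "distinct C" "3 \<le> length C"
    "\<And>i. i < length C \<Longrightarrow> unit_step (C ! i) (C ! (Suc i mod length C))"
    "finite F" "boundary F = step_edges C" "set H \<subseteq> F"
    "boundary (outer (set H)) = step_edges C"
proof -
  let ?A = "set H" and ?O = "outer (set H)"
  obtain h where h: "h \<in> ?A" using H(2) by (cases H) auto
  have far: "\<exists>m. (m, 0) \<in> ?O \<and> (m, 0) \<notin> F" if "finite F" for F :: "(int \<times> int) set"
  proof -
    let ?m = "Max (insert 0 (fst ` (?A \<union> F))) + 1"
    have "\<forall>a \<in> ?A \<union> F. fst a < ?m"
      using that by (auto intro!: zle_add1_eq_le[THEN iffD2] Max_ge)
    moreover have "(?m, 0) \<in> ?O"
      using calculation by (intro outer_far_right) simp
    ultimately show ?thesis by (metis UnI2 fst_conv less_irrefl)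
  qed
  define E where "E u v \<longleftrightarrow> unit_step u v \<and> {u, v} \<in> boundary ?O" for u v
  have "\<exists>c d. unit_step c d \<and> (c \<in> ?O) \<noteq> (d \<in> ?O)"
  proof (rule ccontr)
    assume "\<not> ?thesis"
    then have "(h \<in> ?O) = (c \<in> ?O)" for c
      using unit_step_const[of "\<lambda>c. c \<in> ?O" h c] by blast
    then show False using h outer_not_in far[of "{}"] by blast
  qed
  then obtain c d where cd: "unit_step c d" "wall c d \<in> boundary ?O"
    using wall_in_boundary_iff by blast
  then obtain a b where ab: "E a b" using wall_unit_step[OF cd(1)] E_def by metis
  obtain C where C: "distinct C" "3 \<le> length C"
    "\<And>i. i < length C \<Longrightarrow> E (C ! i) (C ! (Suc i mod length C))"
  proof (rule exists_cycle[of "\<Union>a\<in>?A. cell_corners a" E a b])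
    show "u \<in> (\<Union>a\<in>?A. cell_corners a)" if uv: "E u v" for u v
    proof -
      obtain c d where "unit_step c d" "c \<in> ?O" "d \<notin> ?O" "{u, v} = wall c d"
        using uv unfolding E_def boundary_def by blast
      then have "d \<in> ?A" "u \<in> cell_corners d" using outer_neighbour by (auto simp: wall_def)
      then show ?thesis by blast
    qed
    show "\<exists>w. w \<noteq> u \<and> E v w" if "E u v" for u v
      using boundary_extend that by (auto simp: E_def)
  qed (use ab in \<open>auto simp: E_def cell_corners_def unit_step_sym insert_commute, auto simp: unit_step_def\<close>)
  have CU: "unit_step (C ! i) (C ! (Suc i mod length C))" if "i < length C" for i
    using C(3)[OF that] by (simp add: E_def)
  obtain F where F: "finite F" "boundary F = step_edges C"
    using polygon_bounds[OF C(1,2) CU] by blast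
  have sub: "boundary F \<subseteq> boundary ?O"
    using C(3) by (auto simp: F(2) step_edges_def E_def)
  have sep: "(c \<in> ?O) \<noteq> (d \<in> ?O)" if "unit_step c d" "(c \<in> F) \<noteq> (d \<in> F)" for c d
    using that sub wall_in_boundary_iff[OF that(1)] by blast
  have OF: "c \<notin> F" if "c \<in> ?O" for c
  proof -
    obtain m where m: "(m, 0) \<in> ?O" "(m, 0) \<notin> F" using far[OF F(1)] by blast
    have "(c \<in> F) = ((m, 0) \<in> F)"
    proof (rule outer_const[OF _ that m(1)])
      fix c d assume "(c, d) \<in> free_step ?A"
      then show "(c \<in> F) = (d \<in> F)"
        using sep[of c d] outer_free_step[of c d] by (auto simp: free_step_def)
    qed
    with m(2) show ?thesis by simp
  qed
  have "{C ! 0, C ! (Suc 0 mod length C)} \<in> boundary F"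
    using C(2) unfolding F(2) step_edges_def by (auto intro!: exI[of _ 0])
  then obtain c d where cd: "unit_step c d" "c \<in> F" "d \<notin> F" unfolding boundary_def by blast
  \<comment> \<open>The square on the inner side of the first edge of the polygon belongs to the star cycle.\<close>
  then have "d \<in> ?O" "c \<notin> ?O" using sep[OF cd(1)] OF by blast+
  then have cA: "c \<in> ?A" using outer_neighbour unit_step_sym cd(1) by blast
  have const: "(H ! i \<in> F) = (H ! (Suc i mod length H) \<in> F)" if i: "i < length H" for i
  proof (rule ccontr)
    define p q where "p = H ! i" and "q = H ! (Suc i mod length H)"
    assume "(H ! i \<in> F) \<noteq> (H ! (Suc i mod length H) \<in> F)"
    then have pqF: "(p \<in> F) \<noteq> (q \<in> F)" by (simp add: p_def q_def)
    have "Suc i mod length H < length H" using i by (intro mod_less_divisor) linarith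
    then have "p \<in> ?A" "q \<in> ?A" using i by (auto simp: p_def q_def)
    then have pqO: "p \<notin> ?O" "q \<notin> ?O" using outer_not_in by blast+
    have edge: "{p, q} \<in> step_edges H" using i unfolding step_edges_def p_def q_def by blast
    \<comment> \<open>One of the two sides between \<open>r\<close> and \<open>p\<close>, \<open>q\<close> separates \<open>F\<close> from its complement, so it borders the outer region.\<close>
    have between: "r \<in> ?O" if "unit_step r p" "unit_step r q" for r
      using sep[OF that(1)] sep[OF that(2)] pqF pqO by blast
    have "king_step p q" using king[OF i] by (simp add: p_def q_def)
    moreover have "\<not> unit_step p q" using sep pqF pqO by blast
    ultimately show False
    proof (cases rule: diagonal_stepE)
      case (1 x y)
      have "(x + 1, y) \<in> ?O" "(x, y + 1) \<in> ?O"
        using 1 by (auto intro!: between simp: doubleton_eq_iff unit_step_def)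
      then show False using not_both_outer[OF H king, of "(x, y)" "(x + 1, y + 1)" x y] edge 1 by simp
    next
      case (2 x y)
      have "(x, y) \<in> ?O" "(x + 1, y + 1) \<in> ?O"
        using 2 by (auto intro!: between simp: doubleton_eq_iff unit_step_def)
      then show False using not_both_outer[OF H king, of "(x + 1, y)" "(x, y + 1)" x y] edge 2 by simp
    qed
  qed
  have AF: "?A \<subseteq> F"
    using closed_walk_const[of H "\<lambda>a. a \<in> F" c] const cA cd(2) by blast
  have "boundary ?O \<subseteq> boundary F"
  proof
    fix e assume "e \<in> boundary ?O"
    then obtain c d where "unit_step c d" "c \<in> ?O" "d \<notin> ?O" "e = wall c d"
      unfolding boundary_def by blast
    then show "e \<in> boundary F"
      using wall_in_boundary_iff[of c d F] outer_neighbour[of c ?A d] AF OF by blast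
  qed
  with sub F(2) have "boundary ?O = step_edges C" by simp
  then show thesis using that[OF C(1,2) CU F AF] by blast
qed

section \<open>The squares of the tiling in the complex plane\<close>

definition corner_point :: "int \<times> int \<Rightarrow> complex" where
  "corner_point u = Complex (real_of_int (fst u) + 1/2) (real_of_int (snd u) + 1/2)"

definition closed_square :: "square \<Rightarrow> complex set" where
  "closed_square q = {z. real_of_int (fst q) - 1/2 \<le> Re z \<and> Re z \<le> real_of_int (fst q) + 1/2 \<and>
     real_of_int (snd q) - 1/2 \<le> Im z \<and> Im z \<le> real_of_int (snd q) + 1/2}"

lemma inj_corner_point: "inj corner_point"
  by (auto intro!: injI simp: corner_point_def prod_eq_iff)

lemma corners_eq: "corners q = corner_point ` cell_corners q"
proof -
  have "{f a b | a b. a \<in> S \<and> b \<in> S} = (\<lambda>(a, b). f a b) ` (S \<times> S)"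
    for f :: "real \<Rightarrow> real \<Rightarrow> complex" and S by auto
  then have "corners q = (\<lambda>(a, b). centre q + Complex a b) ` ({-1/2, 1/2} \<times> {-1/2, 1/2})"
    unfolding corners_def .
  also have "\<dots> = corner_point ` cell_corners q"
    by (simp add: cell_corners_def corner_point_def centre_def complex_eq_iff
        insert_Times_insert complex_add insert_commute)
  finally show ?thesis .
qed

lemma dist_corner_point: "dist (corner_point u) (corner_point v) = 1 \<longleftrightarrow> unit_step u v"
proof -
  define a b where "a = fst u - fst v" and "b = snd u - snd v"
  have "dist (corner_point u) (corner_point v) = sqrt (real_of_int (a\<^sup>2 + b\<^sup>2))"
    by (simp add: dist_norm cmod_def corner_point_def a_def b_def)
  then have "dist (corner_point u) (corner_point v) = 1 \<longleftrightarrow> real_of_int (a\<^sup>2 + b\<^sup>2) = real_of_int 1"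
    by simp
  then have *: "dist (corner_point u) (corner_point v) = 1 \<longleftrightarrow> a\<^sup>2 + b\<^sup>2 = 1"
    by (simp only: of_int_eq_iff)
  have "a\<^sup>2 + b\<^sup>2 = 1 \<longleftrightarrow> \<bar>a\<bar> + \<bar>b\<bar> = 1"
  proof
    assume ab: "a\<^sup>2 + b\<^sup>2 = 1"
    have "\<bar>a\<bar> \<le> a\<^sup>2" "\<bar>b\<bar> \<le> b\<^sup>2" 
      using self_le_power[of "\<bar>a\<bar>" 2] self_le_power[of "\<bar>b\<bar>" 2] by (cases "a = 0"; cases "b = 0"; simp)+
    moreover have "a \<noteq> 0 \<or> b \<noteq> 0" using ab by auto
    ultimately show "\<bar>a\<bar> + \<bar>b\<bar> = 1" using ab by linarith
  next
    assume "\<bar>a\<bar> + \<bar>b\<bar> = 1"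
    then have "(\<bar>a\<bar> = 1 \<and> b = 0) \<or> (a = 0 \<and> \<bar>b\<bar> = 1)" by linarith
    then show "a\<^sup>2 + b\<^sup>2 = 1" by (auto simp: power2_eq_1_iff abs_eq_iff')
  qed
  then show ?thesis using * by (simp add: unit_step_def a_def b_def)
qed

lemma cell_edge_wall:
  assumes "unit_step u v" "u \<in> cell_corners q" "v \<in> cell_corners q"
  obtains q' where "unit_step q q'" "{u, v} = wall q q'"
proof -
  obtain x y where q: "q = (x, y)" by fastforce
  have W: "wall q (x + 1, y) = {(x, y - 1), (x, y)}" "wall q (x - 1, y) = {(x - 1, y - 1), (x - 1, y)}"
    "wall q (x, y + 1) = {(x - 1, y), (x, y)}" "wall q (x, y - 1) = {(x - 1, y - 1), (x, y - 1)}"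
    by (auto simp: wall_def cell_corners_def q)
  have U: "unit_step q (x + 1, y)" "unit_step q (x - 1, y)" "unit_step q (x, y + 1)" "unit_step q (x, y - 1)"
    by (auto simp: unit_step_def q)
  have "\<exists>q'. unit_step q q' \<and> {u, v} = wall q q'"
    using assms
  proof (induction u v rule: unit_step_induct)
    case (right a b)
    then have "a = x - 1 \<and> (b = y \<or> b = y - 1)" by (auto simp: cell_corners_def q)
    then have "{(a, b), (a + 1, b)} = wall q (x, y + 1) \<or> {(a, b), (a + 1, b)} = wall q (x, y - 1)"
      unfolding W by auto
    then show ?case using U by blast
  next
    case (up a b)
    then have "b = y - 1 \<and> (a = x \<or> a = x - 1)" by (auto simp: cell_corners_def q)
    then have "{(a, b), (a, b + 1)} = wall q (x + 1, y) \<or> {(a, b), (a, b + 1)} = wall q (x - 1, y)"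
      unfolding W by auto
    then show ?case using U by blast
  next
    case (sym u v)
    then show ?case by (metis insert_commute)
  qed
  then show thesis using that by blast
qed

lemma square_edges_eq: "square_edges q = {corner_point ` wall q q' | q'. unit_step q q'}"
proof (intro subset_antisym subsetI)
  fix e assume "e \<in> square_edges q"
  then obtain u v where uv: "u \<in> cell_corners q" "v \<in> cell_corners q"
      "dist (corner_point u) (corner_point v) = 1" "e = corner_point ` {u, v}"
    by (auto simp: square_edges_def corners_eq)
  then show "e \<in> {corner_point ` wall q q' | q'. unit_step q q'}"
    unfolding dist_corner_point using cell_edge_wall[of u v q] by (metis (mono_tags, lifting) mem_Collect_eq)
next
  fix e assume "e \<in> {corner_point ` wall q q' | q'. unit_step q q'}"
  then obtain q' where q': "unit_step q q'" "e = corner_point ` wall q q'" by blast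
  obtain u v where uv: "unit_step u v" "wall q q' = {u, v}" using wall_unit_step[OF q'(1)] .
  then have "u \<in> cell_corners q" "v \<in> cell_corners q" by (auto simp: wall_def)
  then have "corner_point u \<in> corners q" "corner_point v \<in> corners q" by (auto simp: corners_eq)
  moreover have "dist (corner_point u) (corner_point v) = 1" using uv(1) by (simp add: dist_corner_point)
  moreover have "e = {corner_point u, corner_point v}" using q'(2) uv(2) by simp
  ultimately show "e \<in> square_edges q" unfolding square_edges_def by blast
qed

lemma graph_edges_eq: "graph_edges A = {corner_point ` wall q q' | q q'. q \<in> A \<and> unit_step q q'}"
  by (auto simp: graph_edges_def square_edges_eq)

lemma star_adjacent_iff: "star_adjacent p q \<longleftrightarrow> king_step p q"
proof -
  have "corners p \<inter> corners q = corner_point ` (cell_corners p \<inter> cell_corners q)"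
    by (simp add: corners_eq image_Int[OF inj_corner_point])
  then have "corners p \<inter> corners q \<noteq> {} \<longleftrightarrow>
      {fst p - 1, fst p} \<inter> {fst q - 1, fst q} \<noteq> {} \<and> {snd p - 1, snd p} \<inter> {snd q - 1, snd q} \<noteq> {}"
    by (simp only: cell_corners_def Times_Int_Times Times_empty image_is_empty de_Morgan_disj)
  moreover have "{i - 1, i} \<inter> {j - 1, j} \<noteq> {} \<longleftrightarrow> \<bar>i - j\<bar> \<le> 1" for i j :: int
    by auto
  ultimately show ?thesis by (simp only: star_adjacent_def king_step_def)
qed

lemma hull_wall_right:
  "convex hull (corner_point ` wall (x, y) (x + 1, y)) =
    {z. Re z = x + 1/2 \<and> y - 1/2 \<le> Im z \<and> Im z \<le> y + 1/2}"
  unfolding wall_right image_insert image_empty segment_convex_hull[symmetric]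
  by (subst closed_segment_same_Re) (auto simp: corner_point_def closed_segment_eq_real_ivl)

lemma hull_wall_up:
  "convex hull (corner_point ` wall (x, y) (x, y + 1)) =
    {z. Im z = y + 1/2 \<and> x - 1/2 \<le> Re z \<and> Re z \<le> x + 1/2}"
  unfolding wall_up image_insert image_empty segment_convex_hull[symmetric]
  by (subst closed_segment_same_Im) (auto simp: corner_point_def closed_segment_eq_real_ivl)

lemma segment_centres_right:
  "closed_segment (centre (x, y)) (centre (x + 1, y)) = {z. Im z = y \<and> x \<le> Re z \<and> Re z \<le> x + 1}"
  by (subst closed_segment_same_Im) (auto simp: centre_def closed_segment_eq_real_ivl)

lemma segment_centres_up:
  "closed_segment (centre (x, y)) (centre (x, y + 1)) = {z. Re z = x \<and> y \<le> Im z \<and> Im z \<le> y + 1}"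
  by (subst closed_segment_same_Re) (auto simp: centre_def closed_segment_eq_real_ivl)

lemma open_square_eq:
  "open_square q = {z. real_of_int (fst q) - 1/2 < Re z \<and> Re z < real_of_int (fst q) + 1/2 \<and>
     real_of_int (snd q) - 1/2 < Im z \<and> Im z < real_of_int (snd q) + 1/2}"
  by (auto simp: open_square_def in_box_complex_iff centre_def)

lemma int_le_if_less_plus_1: "real_of_int i < real_of_int j + 1 \<Longrightarrow> i \<le> j"
  using of_int_less_iff[of i "j + 1", where 'a = real] by simp

lemma hull_wall_disjoint_open_square:
  assumes "unit_step c d"
  shows "convex hull (corner_point ` wall c d) \<inter> open_square q = {}"
proof -
  have no: "\<not> (real_of_int i - 1/2 < real_of_int j + 1/2 \<and> real_of_int j + 1/2 < real_of_int i + 1/2)" for i j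
    using int_le_if_less_plus_1[of i j] of_int_le_iff[of i j, where 'a = real] by linarith
  from assms show ?thesis
  proof (induction c d rule: unit_step_induct)
    case (right x y)
    show ?case unfolding hull_wall_right open_square_eq using no[of "fst q" x] by auto
  next
    case (up x y)
    show ?case unfolding hull_wall_up open_square_eq using no[of "snd q" y] by auto
  qed (simp add: wall_commute)
qed

text \<open>
  The segment between the centres of two neighbours meets the grid lines only in the midpoint of the
  common side.
\<close>

lemma hull_wall_meets_segment:
  assumes "unit_step c d" "unit_step p q"
    and "z \<in> convex hull (corner_point ` wall c d)" "z \<in> closed_segment (centre p) (centre q)"
  shows "wall c d = wall p q"
proof -
  have same: "i = j" if "real_of_int i \<le> real_of_int j + 1/2" "real_of_int j \<le> real_of_int i + 1/2" for i j
    using that by (intro antisym int_le_if_less_plus_1) linarith+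
  have no: "real_of_int i + 1/2 \<noteq> real_of_int j" for i j
  proof
    assume "real_of_int i + 1/2 = real_of_int j"
    moreover from this have "i = j" by (intro same) linarith+
    ultimately show False by simp
  qed
  from assms show ?thesis
  proof (induction c d rule: unit_step_induct)
    case (right x y)
    from right(1,3,2) show ?case
    proof (induction p q rule: unit_step_induct)
      case (right a b)
      then have "Re z = x + 1/2" "y - 1/2 \<le> Im z" "Im z \<le> y + 1/2" "Im z = b" "a \<le> Re z" "Re z \<le> a + 1"
        by (auto simp: hull_wall_right segment_centres_right)
      then have "a = x" "b = y" by (intro same; linarith)+
      then show ?case by simp
    next
      case (up a b)
      then show ?case using no[of x a] by (auto simp: hull_wall_right segment_centres_up)
    next
      case (sym p q)
      then show ?case by (metis wall_commute closed_segment_commute)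
    qed
  next
    case (up x y)
    from up(1,3,2) show ?case
    proof (induction p q rule: unit_step_induct)
      case (up a b)
      then have "Im z = y + 1/2" "x - 1/2 \<le> Re z" "Re z \<le> x + 1/2" "Re z = a" "b \<le> Im z" "Im z \<le> b + 1"
        by (auto simp: hull_wall_up segment_centres_up)
      then have "b = y" "a = x" by (intro same; linarith)+
      then show ?case by simp
    next
      case (right a b)
      then show ?case using no[of y b] by (auto simp: hull_wall_up segment_centres_right)
    next
      case (sym p q)
      then show ?case by (metis wall_commute closed_segment_commute)
    qed
  next
    case (sym c d)
    then show ?case by (metis wall_commute)
  qed
qed

lemma closed_squares_meet_in_wall:
  assumes "unit_step c d"
  shows "closed_square c \<inter> closed_square d \<subseteq> convex hull (corner_point ` wall c d)"
  using assms
proof (induction c d rule: unit_step_induct)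
  case (right x y)
  show ?case unfolding hull_wall_right closed_square_def by auto
next
  case (up x y)
  show ?case unfolding hull_wall_up closed_square_def by auto
qed (auto simp: wall_commute)

section \<open>Interior and exterior of lattice curves\<close>

lemma cycle_edge_wall:
  assumes "set (cycle_edges K) \<subseteq> graph_edges A" "z \<in> cycle_curve K"
  obtains q q' where "q \<in> A" "unit_step q q'" "corner_point ` wall q q' \<in> set (cycle_edges K)"
    "z \<in> convex hull (corner_point ` wall q q')"
  using assms unfolding cycle_curve_def graph_edges_eq by blast

lemma open_square_disjoint_curve:
  assumes "set (cycle_edges K) \<subseteq> graph_edges A"
  shows "open_square q \<subseteq> - cycle_curve K"
  using cycle_edge_wall[OF assms] hull_wall_disjoint_open_square by blast

lemma centre_in_open_square: "centre q \<in> open_square q"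
  by (simp add: open_square_eq centre_def)

lemma connected_centres:
  assumes K: "set (cycle_edges K) \<subseteq> graph_edges A"
    and "unit_step c d" "corner_point ` wall c d \<notin> set (cycle_edges K)"
  shows "connected_component (- cycle_curve K) (centre c) (centre d)"
proof (rule connected_componentI)
  show "closed_segment (centre c) (centre d) \<subseteq> - cycle_curve K"
  proof
    fix z assume z: "z \<in> closed_segment (centre c) (centre d)"
    show "z \<in> - cycle_curve K"
    proof
      assume "z \<in> cycle_curve K"
      then obtain q q' where "unit_step q q'" "corner_point ` wall q q' \<in> set (cycle_edges K)"
        "z \<in> convex hull (corner_point ` wall q q')"
        using cycle_edge_wall[OF K] by metis
      then show False using hull_wall_meets_segment[OF _ assms(2) _ z] assms(3) by metis
    qed
  qed
qed auto

text \<open>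
  An open square is connected and does not meet the curve, so its centre decides on which side
  of the curve it lies.
\<close>

lemma open_square_outsideI:
  assumes K: "set (cycle_edges K) \<subseteq> graph_edges A" and "centre q \<in> outside (cycle_curve K)"
  shows "open_square q \<subseteq> outside (cycle_curve K)"
proof
  fix z assume "z \<in> open_square q"
  then have "connected_component (- cycle_curve K) (centre q) z"
    using open_square_disjoint_curve[OF K, of q] centre_in_open_square[of q]
    by (intro connected_componentI[of "open_square q"]) (auto simp: open_square_def intro: convex_connected)
  then show "z \<in> outside (cycle_curve K)" using assms(2) by (rule outside_same_component)
qed

lemma inj_image_corner_point: "corner_point ` X = corner_point ` Y \<longleftrightarrow> X = Y"
  by (rule inj_image_eq_iff[OF inj_corner_point])

text \<open>
  Free moves do not cross the curve, and they connect \<open>q\<close> to squares arbitrarily far to the right.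
\<close>

lemma outer_centre_outside:
  assumes K: "set (cycle_edges K) \<subseteq> graph_edges A" and A: "finite A" and q: "q \<in> outer A"
  shows "centre q \<in> outside (cycle_curve K)"
proof -
  let ?R = "connected_component (- cycle_curve K)"
  have step: "?R (centre c) (centre d)" if "(c, d) \<in> free_step A" for c d
  proof (rule connected_centres[OF K])
    show cd: "unit_step c d" using that by (simp add: free_step_def)
    show "corner_point ` wall c d \<notin> set (cycle_edges K)"
    proof
      assume "corner_point ` wall c d \<in> set (cycle_edges K)"
      then obtain a a' where "a \<in> A" "unit_step a a'" "wall c d = wall a a'"
        using K unfolding graph_edges_eq by (auto simp: inj_image_corner_point)
      then have "{c, d} = {a, a'}" using wall_inj[OF cd] by blast
      with \<open>a \<in> A\<close> that show False by (auto simp: free_step_def doubleton_eq_iff)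
    qed
  qed
  have refl: "?R (centre c) (centre c)" for c
    using open_square_disjoint_curve[OF K, of c] centre_in_open_square[of c] by auto
  have path: "?R (centre c) (centre d)" if "(c, d) \<in> (free_step A)\<^sup>*" for c d
    using that by induction (use refl step connected_component_trans in blast)+
  let ?m = "Max (insert 0 (fst ` A)) + 1"
  have m: "\<forall>a\<in>A. fst a < ?m" using A by (auto intro!: zle_add1_eq_le[THEN iffD2] Max_ge)
  have far: "?R (centre q) (centre (?m + int n, 0))" for n
    using m by (intro path outer_connected q outer_far_right) force
  have "\<not> bounded (connected_component_set (- cycle_curve K) (centre q))"
  proof
    assume "bounded (connected_component_set (- cycle_curve K) (centre q))"
    then obtain B where B: "\<And>z. ?R (centre q) z \<Longrightarrow> norm z \<le> B" unfolding bounded_iff by auto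
    obtain n where n: "B < real n" using reals_Archimedean2 by blast
    have "real n \<le> Re (centre (?m + int n, 0))"
      using A by (auto simp: centre_def intro!: add_nonneg_nonneg Max_ge)
    also have "\<dots> \<le> norm (centre (?m + int n, 0))" by (rule complex_Re_le_cmod)
    also have "\<dots> \<le> B" by (rule B[OF far])
    finally show False using n by simp
  qed
  then show ?thesis by (simp add: outside)
qed

lemma closed_closed_square: "closed (closed_square q)"
  unfolding closed_square_def by (intro closed_Collect_conj closed_Collect_le continuous_intros)

text \<open>
  Even for infinitely many squares, because each point has a neighbourhood that meets only finitely
  many of them.
\<close>

lemma closed_Union_squares: "closed (\<Union>q\<in>Q. closed_square q)"
proof -
  have "locally_finite_in euclidean (closed_square ` Q)"
    unfolding locally_finite_in_def
  proof (intro conjI ballI)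
    fix z :: complex
    let ?V = "{w. \<bar>Re w - Re z\<bar> < 1 \<and> \<bar>Im w - Im z\<bar> < 1}"
    let ?Q = "{\<lfloor>Re z\<rfloor> - 3..\<lfloor>Re z\<rfloor> + 3} \<times> {\<lfloor>Im z\<rfloor> - 3..\<lfloor>Im z\<rfloor> + 3}"
    have "q \<in> ?Q" if overlap: "closed_square q \<inter> ?V \<noteq> {}" for q
    proof -
      obtain w where w: "real_of_int (fst q) - 1/2 \<le> Re w" "Re w \<le> real_of_int (fst q) + 1/2"
        "real_of_int (snd q) - 1/2 \<le> Im w" "Im w \<le> real_of_int (snd q) + 1/2" "\<bar>Re w - Re z\<bar> < 1" "\<bar>Im w - Im z\<bar> < 1"
        using overlap unfolding closed_square_def by blast
      have "\<lfloor>Re z\<rfloor> - 3 \<le> fst q" "fst q \<le> \<lfloor>Re z\<rfloor> + 3" "\<lfloor>Im z\<rfloor> - 3 \<le> snd q" "snd q \<le> \<lfloor>Im z\<rfloor> + 3"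
        using w by linarith+
      then show ?thesis by (cases q) auto
    qed
    then have "{U \<in> closed_square ` Q. U \<inter> ?V \<noteq> {}} \<subseteq> closed_square ` ?Q" by blast
    then have "finite {U \<in> closed_square ` Q. U \<inter> ?V \<noteq> {}}" by (rule finite_subset) simp
    moreover have "open ?V" by (intro open_Collect_conj open_Collect_less continuous_intros)
    ultimately show "\<exists>V. openin euclidean V \<and> z \<in> V \<and> finite {U \<in> closed_square ` Q. U \<inter> V \<noteq> {}}"
      by (intro exI[of _ ?V]) auto
  qed auto
  then have "closedin euclidean (\<Union>(closed_square ` Q))"
    by (rule closedin_locally_finite_Union[rotated]) (auto simp: closed_closed_square)
  then show ?thesis by simp
qed

lemma in_closed_square_round: "z \<in> closed_square (round (Re z), round (Im z))"
  using of_int_round_abs_le[of "Re z"] of_int_round_abs_le[of "Im z"]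
  unfolding closed_square_def abs_le_iff by simp

lemma bounded_closed_square: "bounded (closed_square q)"
proof (rule bounded_subset)
  show "closed_square q \<subseteq> cbox (centre q - Complex (1/2) (1/2)) (centre q + Complex (1/2) (1/2))"
    by (auto simp: closed_square_def in_cbox_complex_iff centre_def)
qed simp

text \<open>
  The closed squares of \<open>F\<close> and those of the complement of \<open>F\<close> cover the plane by two closed sets
  that meet only in the sides bounding \<open>F\<close>. A connected set that avoids these sides and starts in \<open>F\<close>
  therefore stays in the bounded union of the squares of \<open>F\<close>.
\<close>

lemma bounded_region_not_outside:
  assumes F: "finite F" "c \<in> F"
    and S: "\<And>e. e \<in> boundary F \<Longrightarrow> convex hull (corner_point ` e) \<subseteq> S"
  shows "centre c \<notin> outside S"
proof
  assume "centre c \<in> outside S"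
  then have out: "\<not> bounded (connected_component_set (- S) (centre c))" and cS: "centre c \<notin> S"
    by (simp add: outside) (use \<open>centre c \<in> outside S\<close> in \<open>simp add: outside_def\<close>)
  let ?K = "connected_component_set (- S) (centre c)"
  let ?T = "\<Union>f\<in>F. closed_square f" and ?T' = "\<Union>f\<in>-F. closed_square f"
  have step: "z \<in> S" if "unit_step f g" "(f \<in> F) \<noteq> (g \<in> F)" "z \<in> closed_square f" "z \<in> closed_square g" for f g z
    using that closed_squares_meet_in_wall S wall_in_boundary_iff by blast
  have meet: "z \<in> S" if fg: "f \<in> F" "g \<notin> F" "z \<in> closed_square f" "z \<in> closed_square g" for f g z
  proof -
    \<comment> \<open>If \<open>f\<close> and \<open>g\<close> meet only in a corner, pass through a square that shares a side with each of them.\<close>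
    define r where "r = (fst f, snd g)"
    have r: "z \<in> closed_square r" using fg by (simp add: closed_square_def r_def)
    have "fst f \<le> fst g + 1" "fst g \<le> fst f + 1" "snd f \<le> snd g + 1" "snd g \<le> snd f + 1"
      using fg unfolding closed_square_def by (auto intro!: int_le_if_less_plus_1)
    then have "(f = r \<or> unit_step f r) \<and> (r = g \<or> unit_step r g)"
      by (auto simp: r_def unit_step_def prod_eq_iff)
    then show ?thesis using step[of f r z] step[of r g z] fg r by blast
  qed
  have "?T' \<inter> ?K = {}"
  proof (rule ccontr)
    assume "?T' \<inter> ?K \<noteq> {}"
    moreover have "centre c \<in> ?T \<inter> ?K"
      using F(2) cS by (auto simp: closed_square_def centre_def intro!: bexI[of _ c])
    moreover have "?K \<subseteq> ?T \<union> ?T'" using in_closed_square_round by blast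
    moreover have "?T \<inter> ?T' \<inter> ?K = {}" using meet connected_component_subset[of "- S" "centre c"] by blast
    ultimately show False
      using connected_connected_component[of "- S" "centre c"] closed_Union_squares
      unfolding connected_closed by blast
  qed
  then have "?K \<subseteq> ?T" using in_closed_square_round by blast
  moreover have "bounded ?T" using F(1) bounded_closed_square by (intro bounded_UN) auto
  ultimately show False using out bounded_subset by blast
qed

section \<open>The outermost boundary of a star cycle\<close>

lemma star_cycle_king_step:
  assumes "star_cycle H" "i < length H"
  shows "king_step (H ! i) (H ! (Suc i mod length H))"
proof (cases "Suc i = length H")
  case True
  moreover from this have "i = length H - 1" by simp
  moreover have "H \<noteq> []" using assms(2) by auto
  moreover have "king_step (last H) (hd H)" using assms(1) by (simp add: star_cycle_def star_adjacent_iff)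
  ultimately show ?thesis by (simp add: last_conv_nth hd_conv_nth)
next
  case False
  then show ?thesis
    using assms by (simp add: star_cycle_def star_path_def star_adjacent_iff)
qed

lemma set_cycle_edges: "set (cycle_edges C) = step_edges C"
  by (auto simp: cycle_edges_def step_edges_def)

lemma distinct_cycle_edges:
  assumes "distinct C" "3 \<le> length C"
  shows "distinct (cycle_edges C)"
  unfolding cycle_edges_def distinct_map using step_edges_inj[OF assms] by (auto intro!: inj_onI)

lemma step_edges_map: "step_edges (map f C) = (\<lambda>e. f ` e) ` step_edges C"
proof -
  have "{map f C ! i, map f C ! (Suc i mod length C)} = f ` {C ! i, C ! (Suc i mod length C)}"
    if "i < length C" for i
  proof -
    have "Suc i mod length C < length C" using that by (intro mod_less_divisor) linarith
    then show ?thesis using that by simp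
  qed
  then have "(\<lambda>i. {map f C ! i, map f C ! (Suc i mod length C)}) ` {..<length C} =
      (\<lambda>i. f ` {C ! i, C ! (Suc i mod length C)}) ` {..<length C}"
    by (intro image_cong refl) (simp only: lessThan_iff)
  then show ?thesis by (simp only: step_edges_image length_map image_image)
qed

theorem theorem4:
  fixes H :: "square list"
  assumes "star_cycle H" and "3 \<le> length H"
  shows "\<exists>C. is_cycle (set H) C \<and> outermost_boundary (set H) = set (cycle_edges C)"
proof -
  let ?A = "set H"
  have "distinct H" using assms(1) by (simp add: star_cycle_def star_path_def)
  then obtain P F where P: "distinct P" "3 \<le> length P"
    and F: "finite F" "boundary F = step_edges P" "?A \<subseteq> F"
    and O: "boundary (outer ?A) = step_edges P"
    using outer_boundary_polygon[OF _ assms(2) star_cycle_king_step[OF assms(1)]] by metis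
  define C where "C = map corner_point P"
  have edges: "set (cycle_edges C) = (\<lambda>e. corner_point ` e) ` boundary (outer ?A)"
    unfolding set_cycle_edges C_def step_edges_map O ..
  have in_C: "corner_point ` wall c d \<in> set (cycle_edges C) \<longleftrightarrow> wall c d \<in> boundary (outer ?A)" for c d
    unfolding edges by (auto simp: inj_image_corner_point)
  have side: "\<exists>c d. unit_step c d \<and> c \<in> outer ?A \<and> d \<in> ?A \<and> e = corner_point ` wall c d"
    if "e \<in> set (cycle_edges C)" for e
    using that outer_neighbour unfolding edges boundary_def by blast
  have sub: "set (cycle_edges C) \<subseteq> graph_edges ?A"
    using side unit_step_sym wall_commute unfolding graph_edges_eq by blast
  have "is_cycle ?A C"
    unfolding is_cycle_def
  proof (intro conjI)
    show "C \<noteq> []" "distinct C"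
      using P inj_corner_point by (auto simp: C_def distinct_map intro: inj_on_subset)
    then show "distinct (cycle_edges C)" using P(2) by (intro distinct_cycle_edges) (simp_all add: C_def)
    show "set C \<subseteq> graph_vertices ?A"
    proof
      fix v assume "v \<in> set C"
      then obtain i where "i < length C" "v = C ! i" by (metis in_set_conv_nth)
      then obtain e where e: "e \<in> set (cycle_edges C)" "v \<in> e"
        unfolding set_cycle_edges step_edges_def by blast
      then obtain c d where "d \<in> ?A" "v \<in> corner_point ` wall c d" using side by blast
      then show "v \<in> graph_vertices ?A"
        unfolding graph_vertices_def corners_eq wall_def by blast
    qed
  qed (rule sub)
  moreover have "outermost_boundary ?A = set (cycle_edges C)"
  proof (intro subset_antisym subsetI)
    fix e assume e: "e \<in> outermost_boundary ?A"
    show "e \<in> set (cycle_edges C)"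
    proof (rule ccontr)
      assume "e \<notin> set (cycle_edges C)"
      then have ext: "edge_in_exterior e C"
        using e \<open>is_cycle ?A C\<close> unfolding outermost_boundary_def by blast
      obtain q where q: "q \<in> ?A" "e \<in> square_edges q"
        using e unfolding outermost_boundary_def graph_edges_def by blast
      then have "centre q \<in> outside (cycle_curve C)"
        using ext centre_in_open_square unfolding edge_in_exterior_def square_in_exterior_def by blast
      moreover have "centre q \<notin> outside (cycle_curve C)"
      proof (rule bounded_region_not_outside[OF F(1)])
        show "q \<in> F" using q F(3) by blast
        show "convex hull (corner_point ` e) \<subseteq> cycle_curve C" if "e \<in> boundary F" for e
          using that unfolding cycle_curve_def edges O F(2) by blast
      qed
      ultimately show False by blast
    qed
  next
    fix e assume e: "e \<in> set (cycle_edges C)"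
    then obtain c d where cd: "unit_step c d" "c \<in> outer ?A" "d \<in> ?A" "e = corner_point ` wall c d"
      using side by blast
    have "edge_in_exterior e K" if "is_cycle ?A K" "e \<notin> set (cycle_edges K)" for K
      unfolding edge_in_exterior_def square_in_exterior_def
    proof (intro allI impI)
      have K: "set (cycle_edges K) \<subseteq> graph_edges ?A" using that(1) by (simp add: is_cycle_def)
      have c: "centre c \<in> outside (cycle_curve K)"
        using outer_centre_outside[OF K _ cd(2)] by simp
      then have d: "centre d \<in> outside (cycle_curve K)"
        using connected_centres[OF K cd(1)] that(2) cd(4) outside_same_component by blast
      fix q assume "e \<in> square_edges q"
      then obtain q' where "unit_step q q'" "wall c d = wall q q'"
        unfolding square_edges_eq cd(4) by (auto simp: inj_image_corner_point)
      then have "{c, d} = {q, q'}" by (rule wall_inj[OF cd(1)])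
      then have "q = c \<or> q = d" by (auto simp: doubleton_eq_iff)
      then show "open_square q \<subseteq> outside (cycle_curve K)"
        using open_square_outsideI[OF K] c d by blast
    qed
    then show "e \<in> outermost_boundary ?A"
      using e sub unfolding outermost_boundary_def by blast
  qed
  ultimately show ?thesis by blast
qed

end
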